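(* Let $a>0$, $b>0$ be real, let $x\in(0,1]$ and $\xi=-\ln x\ge0$. Let the sequence $F_n=F_n(\xi,a,b)$, $n\ge0$, be defined by $$F_0=a^{-b}Q(b,a\xi),\qquad F_1=\frac{b-a\xi}{a}F_0+\frac{\xi^b e^{-a\xi}}{a\,\Gamma(b)},$$ $$aF_{n+1}=(n+b-a\xi)F_n+n\xi F_{n-1}\qquad(n\ge1).$$ Then for every non-negative integer $n$, $$0<F_{n+1}\le\frac{n+\beta}{a}F_n,\qquad\text{where }\beta=\max(1,b).$$
   Context: For $s>0$ and $z\ge0$, $Q(s,z)=\Gamma(s,z)/\Gamma(s)$ is the normalised upper incomplete gamma function, with $\Gamma(s,z)=\int_z^{+\infty}t^{s-1}e^{-t}\,dt$. *)

theory Defs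
  imports "HOL-Analysis.Analysis"
begin

(* Meaningful for s > 0 and z >= 0, where the integral converges; a divergent one would be 0. *)
definition upper_Gamma :: "real \<Rightarrow> real \<Rightarrow> real" where
  "upper_Gamma s z = integral {z..} (\<lambda>t. t powr (s - 1) * exp (- t))"

definition Q_Gamma :: "real \<Rightarrow> real \<Rightarrow> real" where
  "Q_Gamma s z = upper_Gamma s z / Gamma s"

end

theory Submission
  imports Defs "HOL-Real_Asymp.Real_Asymp"
begin

text \<open>
  The sequence consists of the shifted moments
  \<open>F n = (1 / Gamma b) * integral over t > \<xi> of (t - \<xi>)^n * t powr (b - 1) * exp (- a * t)\<close>:
  integrating the derivative of \<open>(t - \<xi>)^n * t powr b * exp (- a * t)\<close> gives the recurrence,
  and positivity is immediate. Integrating the derivative of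
  \<open>(t - \<xi>)^(n + 1) * t powr (b - 1) * exp (- a * t)\<close> gives
  \<open>a * F (n + 1) = (n + 1) * F n + (b - 1) * R\<close>, where the integrand of \<open>R\<close> is that of \<open>F n\<close>
  multiplied by \<open>(t - \<xi>) / t\<close>, so that \<open>0 \<le> R \<le> F n\<close>; hence the upper bound.
\<close>

text \<open>Here and in all auxiliary lemmas \<open>x\<close> plays the role of \<xi>, not of the
  theorem's x. The factor \<open>1 / Gamma b\<close> is left out and restored only in the final
  proof.\<close>

definition moment_kernel :: "real \<Rightarrow> real \<Rightarrow> real \<Rightarrow> nat \<Rightarrow> real \<Rightarrow> real" where
  "moment_kernel a b x n t = (t - x) ^ n * (t powr (b - 1) * exp (- (a * t)))"

definition moment :: "real \<Rightarrow> real \<Rightarrow> real \<Rightarrow> nat \<Rightarrow> real" where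
  "moment a b x n = (LBINT t:{x<..}. moment_kernel a b x n t)"

text \<open>The integrand is the norm of the complex Gamma integrand with rate \<open>a\<close>,
  whose absolute integrability is known. Borel measurability then allows the passage from Lebesgue
  measure to \<open>lborel\<close>.\<close>

lemma set_integrable_powr_exp:
  fixes a s :: real
  assumes "a > 0" "s > 0"
  shows "set_integrable lborel {0<..} (\<lambda>t. t powr (s - 1) * exp (- (a * t)))"
proof -
  have "(\<lambda>t. norm (complex_of_real t powr (complex_of_real s - 1) / of_real (exp (a * t))))
          absolutely_integrable_on {0<..}"
    using absolutely_integrable_Gamma_integral[of "complex_of_real s" a] assms
    by (intro absolutely_integrable_norm[unfolded comp_def]) auto
  also have "?this \<longleftrightarrow>
      set_integrable lebesgue {0<..} (\<lambda>t. t powr (s - 1) * exp (- (a * t)))"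
    by (intro set_integrable_cong) (auto simp: norm_divide norm_powr_real_powr exp_minus field_simps)
  finally show ?thesis
    unfolding set_integrable_def by (subst (asm) integrable_completion) auto
qed

lemma moment_kernel_measurable [measurable]: "moment_kernel a b x n \<in> borel_measurable borel"
  unfolding moment_kernel_def[abs_def] by measurable

lemma moment_kernel_nonneg: "x < t \<Longrightarrow> 0 \<le> moment_kernel a b x n t"
  by (simp add: moment_kernel_def)

lemma moment_kernel_pos: "0 \<le> x \<Longrightarrow> x < t \<Longrightarrow> 0 < moment_kernel a b x n t"
  by (simp add: moment_kernel_def)

text \<open>Since \<open>x \<ge> 0\<close>, the power of \<open>t - x\<close> is at most
  \<open>t ^ n\<close>, so a Gamma integrand with exponent parameter \<open>n + b\<close> dominates
  the kernel.\<close>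

lemma set_integrable_moment_kernel:
  assumes "a > 0" "b > 0" "x \<ge> 0"
  shows "set_integrable lborel {x<..} (moment_kernel a b x n)"
proof (rule set_integrable_bound)
  show "set_integrable lborel {x<..} (\<lambda>t. t powr (real n + b - 1) * exp (- (a * t)))"
    by (rule set_integrable_subset[OF set_integrable_powr_exp]) (use assms in auto)
  show "set_borel_measurable lborel {x<..} (moment_kernel a b x n)"
    unfolding set_borel_measurable_def by measurable
  show "AE t in lborel. t \<in> {x<..} \<longrightarrow>
      norm (moment_kernel a b x n t) \<le> norm (t powr (real n + b - 1) * exp (- (a * t)))"
  proof (intro AE_I2 impI)
    fix t assume t: "t \<in> {x<..}"
    have "moment_kernel a b x n t \<le> t ^ n * (t powr (b - 1) * exp (- (a * t)))"
      unfolding moment_kernel_def using t assms by (intro mult_right_mono power_mono) auto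
    also have "\<dots> = t powr (real n + b - 1) * exp (- (a * t))"
      using t assms by (simp add: powr_realpow[symmetric] powr_add[symmetric] add_diff_eq)
    finally show "norm (moment_kernel a b x n t) \<le> norm (t powr (real n + b - 1) * exp (- (a * t)))"
      using moment_kernel_nonneg[of x t a b n] t by simp
  qed
qed

lemma moment_pos:
  assumes "a > 0" "b > 0" "x \<ge> 0"
  shows "moment a b x n > 0"
proof -
  let ?f = "\<lambda>t. indicator {x<..} t * moment_kernel a b x n t"
  have int: "integrable lborel ?f"
    using set_integrable_moment_kernel[OF assms, of n] by (simp add: set_integrable_def)
  have nonneg: "?f t \<ge> 0" for t
    using moment_kernel_nonneg[of x t a b n] by (auto simp: indicator_def)
  have "integral\<^sup>L lborel ?f \<noteq> 0"
  proof
    assume "integral\<^sup>L lborel ?f = 0"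
    then have "AE t in lborel. ?f t = 0"
      using integral_nonneg_eq_0_iff_AE[OF int] nonneg by simp
    \<comment> \<open>The kernel is strictly positive on the whole ray, so a vanishing integral
      would make this interval of measure 1 a null set.\<close>
    then have "AE t in lborel. t \<notin> {x<..<x+1}"
    proof eventually_elim
      case (elim t)
      then show ?case using moment_kernel_pos[OF assms(3), of t a b n] by (auto simp: indicator_def)
    qed
    then have "{x<..<x+1} \<in> null_sets lborel"
      by (subst AE_iff_null_sets) auto
    then show False by (auto simp: null_sets_def)
  qed
  moreover have "integral\<^sup>L lborel ?f \<ge> 0"
    using nonneg by (intro integral_nonneg_AE) auto
  ultimately show ?thesis
    by (simp add: moment_def set_lebesgue_integral_def)
qed

text \<open>Only one-sided limits of the antiderivative are required at the ends. This matters for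
  \<open>x = 0\<close>, where the weight \<open>t powr (b - 1)\<close> is singular if
  \<open>b < 1\<close>.\<close>

lemma LBINT_greaterThan_FTC:
  fixes f G :: "real \<Rightarrow> real"
  assumes "\<And>t. x < t \<Longrightarrow> (G has_real_derivative f t) (at t)"
    and "\<And>t. x < t \<Longrightarrow> isCont f t"
    and "set_integrable lborel {x<..} f"
    and "(G \<longlongrightarrow> A) (at_right x)" "(G \<longlongrightarrow> B) at_top"
  shows "(LBINT t:{x<..}. f t) = B - A"
proof -
  have "(LBINT t=ereal x..\<infinity>. f t) = B - A"
    using assms
    by (intro interval_integral_FTC_integrable[of _ _ G])
       (auto simp: ereal_tendsto_simps has_real_derivative_iff_has_vector_derivative)
  then show ?thesis by (simp add: interval_integral_to_infinity_eq)
qed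

lemma DERIV_shifted_power_powr_exp:
  fixes a c t x :: real
  assumes "t > 0"
  shows "((\<lambda>t. (t - x) ^ m * t powr c * exp (- (a * t))) has_real_derivative
      real m * (t - x) ^ (m - 1) * t powr c * exp (- (a * t))
      + (t - x) ^ m * (c * t powr (c - 1)) * exp (- (a * t))
      - a * (t - x) ^ m * t powr c * exp (- (a * t))) (at t)"
  using assms by (auto intro!: derivative_eq_intros simp: algebra_simps)

lemma moment_kernel_tendsto_0_at_top:
  assumes "a > 0"
  shows "(moment_kernel a b x n \<longlongrightarrow> 0) at_top"
  unfolding moment_kernel_def[abs_def] using assms by real_asymp

text \<open>The factor \<open>0 ^ n\<close> lets one identity serve twice: for \<open>n = 0\<close>
  the boundary term at \<open>x\<close> survives and yields the formula for \<open>F 1\<close>, for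
  \<open>n \<ge> 1\<close> it vanishes and yields the recurrence. At \<open>n = 0\<close> the
  truncated index \<open>n - 1\<close> is harmless because its coefficient is zero.\<close>

lemma moment_recurrence:
  assumes "a > 0" "b > 0" "x \<ge> 0"
  shows "(real n + b - a * x) * moment a b x n + real n * x * moment a b x (n - 1)
           - a * moment a b x (n + 1) = - (0 ^ n * x powr b * exp (- (a * x)))"
proof -
  let ?k = "moment_kernel a b x"
  have int: "set_integrable lborel {x<..} (?k m)" for m
    using set_integrable_moment_kernel[OF assms] .
  have "(LBINT t:{x<..}. (real n + b - a * x) * ?k n t + real n * x * ?k (n - 1) t - a * ?k (n + 1) t)
        = 0 - 0 ^ n * x powr b * exp (- (a * x))"
  proof (rule LBINT_greaterThan_FTC)
    fix t assume t: "x < t"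
    \<comment> \<open>Writing the split-off factor as \<open>t = (t - x) + x\<close> turns the
      derivative into a combination of the kernels of orders \<open>n - 1\<close>, \<open>n\<close>
      and \<open>n + 1\<close>.\<close>
    have p: "t powr b = t * t powr (b - 1)"
      using t assms by (simp add: powr_diff)
    have "((\<lambda>t. (t - x) ^ n * t powr b * exp (- (a * t))) has_real_derivative
        real n * (t - x) ^ (n - 1) * t powr b * exp (- (a * t))
        + (t - x) ^ n * (b * t powr (b - 1)) * exp (- (a * t))
        - a * (t - x) ^ n * t powr b * exp (- (a * t))) (at t)"
      using t assms by (intro DERIV_shifted_power_powr_exp) simp
    also have "real n * (t - x) ^ (n - 1) * t powr b * exp (- (a * t))
        + (t - x) ^ n * (b * t powr (b - 1)) * exp (- (a * t))
        - a * (t - x) ^ n * t powr b * exp (- (a * t))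
        = (real n + b - a * x) * ?k n t + real n * x * ?k (n - 1) t - a * ?k (n + 1) t"
      unfolding moment_kernel_def p by (cases n) (auto simp: algebra_simps)
    finally show "((\<lambda>t. (t - x) ^ n * t powr b * exp (- (a * t))) has_real_derivative
        (real n + b - a * x) * ?k n t + real n * x * ?k (n - 1) t - a * ?k (n + 1) t) (at t)" .
  next
    fix t assume t: "x < t"
    show "isCont (\<lambda>t. (real n + b - a * x) * ?k n t + real n * x * ?k (n - 1) t - a * ?k (n + 1) t) t"
      unfolding moment_kernel_def using t assms by (intro continuous_intros) auto
  next
    show "set_integrable lborel {x<..}
        (\<lambda>t. (real n + b - a * x) * ?k n t + real n * x * ?k (n - 1) t - a * ?k (n + 1) t)"
      by (intro set_integral_add set_integral_diff set_integrable_mult_right int)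
  next
    have "((\<lambda>t. (t - x) ^ n * t powr b * exp (- (a * t))) \<longlongrightarrow>
        (x - x) ^ n * x powr b * exp (- (a * x))) (at_right x)"
      using assms by (intro tendsto_intros tendsto_powr') (auto simp: eventually_at_filter)
    then show "((\<lambda>t. (t - x) ^ n * t powr b * exp (- (a * t))) \<longlongrightarrow>
        0 ^ n * x powr b * exp (- (a * x))) (at_right x)" by simp
  next
    show "((\<lambda>t. (t - x) ^ n * t powr b * exp (- (a * t))) \<longlongrightarrow> 0) at_top"
      \<comment> \<open>The antiderivative is itself a kernel, with \<open>b + 1\<close> in place of
        \<open>b\<close>.\<close>
      using moment_kernel_tendsto_0_at_top[OF assms(1), of "b + 1" x n]
      by (simp add: moment_kernel_def[abs_def] mult.assoc)
  qed
  then show ?thesis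
    by (simp add: moment_def int set_integral_add set_integral_diff)
qed

lemma moment_Suc_le:
  assumes "a > 0" "b > 0" "x \<ge> 0"
  shows "a * moment a b x (n + 1) \<le> (real n + max 1 b) * moment a b x n"
proof -
  let ?k = "moment_kernel a b x"
  let ?r = "\<lambda>t. (t - x) / t * ?k n t"
  have int: "set_integrable lborel {x<..} (?k m)" for m
    using set_integrable_moment_kernel[OF assms] .
  have r_bounds: "0 \<le> ?r t" "?r t \<le> ?k n t" if "x < t" for t
  proof -
    have "0 \<le> (t - x) / t" "(t - x) / t \<le> 1"
      using that assms by auto
    with moment_kernel_nonneg[OF that] show "0 \<le> ?r t" "?r t \<le> ?k n t"
      by (blast intro: mult_nonneg_nonneg mult_left_le_one_le)+
  qed
  have int_r: "set_integrable lborel {x<..} ?r"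
  proof (rule set_integrable_bound[OF int[of n]])
    show "set_borel_measurable lborel {x<..} ?r"
      unfolding set_borel_measurable_def by measurable
    show "AE t in lborel. t \<in> {x<..} \<longrightarrow> norm (?r t) \<le> norm (?k n t)"
      using r_bounds moment_kernel_nonneg[of x _ a b n] by (intro AE_I2) (auto simp del: times_divide_eq_left)
  qed
  have "(LBINT t:{x<..}. real (n + 1) * ?k n t + (b - 1) * ?r t - a * ?k (n + 1) t) = 0 - 0"
  proof (rule LBINT_greaterThan_FTC)
    fix t assume t: "x < t"
    have p: "t powr (b - 1 - 1) = t powr (b - 1) / t"
      using t assms by (simp add: powr_diff power2_eq_square)
    have "((\<lambda>t. (t - x) ^ (n + 1) * (t powr (b - 1) * exp (- (a * t)))) has_real_derivative
        real (n + 1) * (t - x) ^ n * t powr (b - 1) * exp (- (a * t))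
        + (t - x) ^ (n + 1) * ((b - 1) * t powr (b - 1 - 1)) * exp (- (a * t))
        - a * (t - x) ^ (n + 1) * t powr (b - 1) * exp (- (a * t))) (at t)"
      using t assms DERIV_shifted_power_powr_exp[of t x "n + 1" "b - 1" a]
      by (simp add: mult.assoc)
    also have "real (n + 1) * (t - x) ^ n * t powr (b - 1) * exp (- (a * t))
        + (t - x) ^ (n + 1) * ((b - 1) * t powr (b - 1 - 1)) * exp (- (a * t))
        - a * (t - x) ^ (n + 1) * t powr (b - 1) * exp (- (a * t))
        = real (n + 1) * ?k n t + (b - 1) * ?r t - a * ?k (n + 1) t"
      unfolding moment_kernel_def p by (simp add: mult_ac)
    finally show "(?k (n + 1) has_real_derivative
        real (n + 1) * ?k n t + (b - 1) * ?r t - a * ?k (n + 1) t) (at t)"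
      by (simp only: moment_kernel_def[abs_def])
  next
    fix t assume t: "x < t"
    show "isCont (\<lambda>t. real (n + 1) * ?k n t + (b - 1) * ?r t - a * ?k (n + 1) t) t"
      unfolding moment_kernel_def using t assms by (intro continuous_intros) auto
  next
    show "set_integrable lborel {x<..} (\<lambda>t. real (n + 1) * ?k n t + (b - 1) * ?r t - a * ?k (n + 1) t)"
      by (intro set_integral_add set_integral_diff set_integrable_mult_right int int_r)
  next
    show "(?k (n + 1) \<longlongrightarrow> 0) (at_right x)"
    \<comment> \<open>At \<open>x = 0\<close> the weight may blow up; one factor of
      \<open>t ^ (n + 1)\<close> is then absorbed into it, giving \<open>t powr b\<close>, which
      tends to 0 because \<open>b > 0\<close>. For \<open>x > 0\<close> the weight is continuous at
      \<open>x\<close> and the power of \<open>t - x\<close> gives the limit 0.\<close>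
    proof (cases "x = 0")
      case True
      have "((\<lambda>t. t ^ n * t powr b * exp (- (a * t))) \<longlongrightarrow> 0 ^ n * 0 powr b * exp (- (a * 0))) (at_right 0)"
        using assms by (intro tendsto_intros tendsto_powr') (auto simp: eventually_at_filter)
      moreover have "\<forall>\<^sub>F t in at_right 0. t ^ n * t powr b * exp (- (a * t)) = ?k (n + 1) t"
        unfolding eventually_at_filter
        by (intro always_eventually) (auto simp: moment_kernel_def True powr_diff)
      ultimately show ?thesis
        using True by (auto elim: Lim_transform_eventually)
    next
      case False
      then have "(?k (n + 1) \<longlongrightarrow> (x - x) ^ (n + 1) * (x powr (b - 1) * exp (- (a * x)))) (at_right x)"
        unfolding moment_kernel_def[abs_def] by (intro tendsto_intros) auto
      then show ?thesis by simp
    qed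
  next
    show "(?k (n + 1) \<longlongrightarrow> 0) at_top"
      by (rule moment_kernel_tendsto_0_at_top[OF assms(1)])
  qed
  then have eq: "a * moment a b x (n + 1) =
      real (n + 1) * moment a b x n + (b - 1) * (LBINT t:{x<..}. ?r t)"
    by (simp add: moment_def int int_r set_integral_add set_integral_diff
        del: times_divide_eq_left)
  have r_nonneg: "(LBINT t:{x<..}. ?r t) \<ge> 0"
    unfolding set_lebesgue_integral_def using r_bounds(1)
    by (intro integral_nonneg_AE AE_I2) (auto simp: indicator_def simp del: times_divide_eq_left)
  have r_le: "(LBINT t:{x<..}. ?r t) \<le> moment a b x n"
    unfolding moment_def using r_bounds by (intro set_integral_mono int int_r) auto
  \<comment> \<open>This is the origin of the maximum in \<beta>: for \<open>b < 1\<close> the left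
    side is nonpositive and the right side is 0, while for \<open>b \<ge> 1\<close> the upper bound
    on the remainder integral is used.\<close>
  have "(b - 1) * (LBINT t:{x<..}. ?r t) \<le> (max 1 b - 1) * moment a b x n"
    using r_nonneg r_le by (intro mult_mono) auto
  moreover have "(real n + max 1 b) * moment a b x n
      = real (n + 1) * moment a b x n + (max 1 b - 1) * moment a b x n"
    by (simp add: algebra_simps)
  ultimately show ?thesis using eq by linarith
qed

text \<open>Substitution \<open>u = a * t\<close> in the incomplete gamma integral: the Jacobian
  \<open>a\<close> and the factor \<open>a powr (b - 1)\<close> from the weight combine to
  \<open>a powr b\<close>.\<close>

lemma moment_0:
  assumes "a > 0" "b > 0" "x \<ge> 0"
  shows "moment a b x 0 = a powr (- b) * upper_Gamma b (a * x)"
proof -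
  let ?g = "\<lambda>t. t powr (b - 1) * exp (- t)"
  have int: "set_integrable lborel {a * x<..} ?g"
    using set_integrable_moment_kernel[of 1 b "a * x" 0] assms by (simp add: moment_kernel_def[abs_def])
  \<comment> \<open>The closed and the open ray differ by one point.\<close>
  have "upper_Gamma b (a * x) = integral {a * x<..} ?g"
    unfolding upper_Gamma_def
    by (rule integral_subset_negligible[symmetric])
       (auto intro: negligible_subset[OF negligible_sing[of "a * x"]])
  also have "\<dots> = (LBINT t:{a * x<..}. ?g t)"
    using set_borel_integral_eq_integral(2)[OF int] by simp
  also have "\<dots> = a * (\<integral>t. indicator {a * x<..} (0 + a * t) * ?g (0 + a * t) \<partial>lborel)"
    unfolding set_lebesgue_integral_def
    using lborel_integral_real_affine[of a "\<lambda>t. indicator {a * x<..} t * ?g t" 0] assms by simp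
  also have "(\<integral>t. indicator {a * x<..} (0 + a * t) * ?g (0 + a * t) \<partial>lborel)
      = (\<integral>t. a powr (b - 1) * (indicator {x<..} t * moment_kernel a b x 0 t) \<partial>lborel)"
    using assms
    by (intro Bochner_Integration.integral_cong)
       (auto simp: indicator_def moment_kernel_def powr_mult)
  also have "a * \<dots> = a powr b * moment a b x 0"
    using assms by (simp add: moment_def set_lebesgue_integral_def powr_diff)
  finally show ?thesis
    using assms by (simp add: powr_minus field_simps)
qed

theorem mainTheorem2:
  fixes a b x \<xi> \<beta> :: real and F :: "nat \<Rightarrow> real"
  assumes "a > 0" and "b > 0"
    and "x \<in> {0<..1}"
    and "\<xi> = - ln x"
    and "\<beta> = max 1 b"
    and "F 0 = a powr (- b) * Q_Gamma b (a * \<xi>)"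
    and "F 1 = (b - a * \<xi>) / a * F 0 + \<xi> powr b * exp (- a * \<xi>) / (a * Gamma b)"
    and "\<And>n. n \<ge> 1 \<Longrightarrow>
           a * F (n + 1) = (real n + b - a * \<xi>) * F n + real n * \<xi> * F (n - 1)"
  shows "\<forall>n. 0 < F (n + 1) \<and> F (n + 1) \<le> (real n + \<beta>) / a * F n"
proof -
  have xi: "\<xi> \<ge> 0" using assms(3,4) by auto
  note pos = assms(1,2) xi
  have Gamma_pos: "Gamma b > 0" using assms(2) by (rule Gamma_real_pos)
  let ?M = "\<lambda>n. moment a b \<xi> n / Gamma b"
  have rec: "a * ?M (n + 1) = (real n + b - a * \<xi>) * ?M n + real n * \<xi> * ?M (n - 1)
      + 0 ^ n * \<xi> powr b * exp (- (a * \<xi>)) / Gamma b" for n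
    using moment_recurrence[OF pos, of n] Gamma_pos by (simp add: field_simps)
  have F0: "F 0 = ?M 0"
    by (simp add: assms(6) moment_0[OF pos] Q_Gamma_def)
  have "a * F 1 = (b - a * \<xi>) * F 0 + \<xi> powr b * exp (- (a * \<xi>)) / Gamma b"
    using assms(1,7) by (simp add: distrib_left)
  also have "\<dots> = a * ?M 1"
    using rec[of 0] by (simp add: F0)
  finally have F1: "F 1 = ?M 1"
    using assms(1) by (simp only: mult_cancel_left) simp
  \<comment> \<open>The recurrence has order two, so the induction carries two consecutive
    values.\<close>
  have F: "F n = ?M n \<and> F (n + 1) = ?M (n + 1)" for n
  proof (induction n)
    case 0
    then show ?case using F0 F1 by simp
  next
    case (Suc n)
    have "a * F (Suc n + 1) = a * ?M (Suc n + 1)"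
      using assms(8)[of "Suc n"] rec[of "Suc n"] Suc by simp
    then have "F (Suc n + 1) = ?M (Suc n + 1)"
      using assms(1) by (simp only: mult_cancel_left) simp
    then show ?case using Suc by simp
  qed
  show ?thesis
  proof (intro allI conjI)
    fix n
    show "0 < F (n + 1)" using F moment_pos[OF pos] Gamma_pos by simp
    \<comment> \<open>Expanding the fraction by \<open>a\<close> exposes the product bounded by
      \<open>moment_Suc_le\<close>.\<close>
    have "F (n + 1) = a * moment a b \<xi> (n + 1) / (a * Gamma b)"
      using F assms(1) by simp
    also have "\<dots> \<le> (real n + \<beta>) * moment a b \<xi> n / (a * Gamma b)"
      using moment_Suc_le[OF pos, of n] assms(1,5) Gamma_pos by (intro divide_right_mono) auto
    also have "\<dots> = (real n + \<beta>) / a * F n" using F by simp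
    finally show "F (n + 1) \<le> (real n + \<beta>) / a * F n" .
  qed
qed

end
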